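(* Let $\alpha>-\tfrac12$. Then there are positive constants $c_{1,\alpha}$ and $c_{2,\alpha}$, depending only on $\alpha$, such that $$c_{1,\alpha}\min\{1,(\lambda t)^2\}\le 1-j_\alpha(\lambda t)\le c_{2,\alpha}\min\{1,(\lambda t)^2\}$$ for all $\lambda>0$ and all $t>0$.
   Context: $j_\alpha$ is the normalized spherical Bessel function of order $\alpha$: $j_\alpha(r)=2^\alpha\Gamma(\alpha+1)\,r^{-\alpha}J_\alpha(r)$ for $r>0$, where $J_\alpha$ is the Bessel function of the first kind of order $\alpha$ (and $j_\alpha(0)=1$). *)

theory Defs
  imports "HOL-Analysis.Analysis"
begin

(* Power series definition of the Bessel function of the first kind of real order a, meant for
   x > 0 (real powers are taken with powr). rGamma = 1/Gamma is entire, so the terms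
   at poles of Gamma (negative integer orders) vanish as usual. *)
definition bessel_J :: "real \<Rightarrow> real \<Rightarrow> real" where
  "bessel_J a x =
     (\<Sum>m. (-1) ^ m / fact m * rGamma (real m + a + 1) * (x / 2) powr (2 * real m + a))"

(* Meant for r \<ge> 0. *)
definition normalized_bessel_j :: "real \<Rightarrow> real \<Rightarrow> real" where
  "normalized_bessel_j a r =
     (if r = 0 then 1 else 2 powr a * Gamma (a + 1) * r powr (- a) * bessel_J a r)"

end

theory Submission
  imports Defs
begin

text \<open>
  With \<open>b = \<alpha> + 1\<close> one has \<open>j\<^sub>\<alpha>(x) = F(x\<^sup>2 / 4)\<close>, where \<open>F(y) = \<^sub>0F\<^sub>1(; b; - y)\<close> is entire and
  solves \<open>y F'' + b F' + F = 0\<close>. Hence the energy \<open>E = F\<^sup>2 + y F'\<^sup>2\<close> satisfies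
  \<open>E' = - (2 b - 1) F'\<^sup>2 \<le> 0\<close> for \<open>b > 1/2\<close>, with \<open>E(0) = 1\<close>, and \<open>E\<close> cannot be constant on an
  interval: there \<open>F' = 0\<close>, so \<open>F = 0\<close> by the equation and \<open>E = 0\<close>. Since \<open>F\<^sup>2 \<le> E\<close>, this
  bounds \<open>F\<close> away from 1 on \<open>[1, \<infinity>)\<close>. On \<open>[0, 1]\<close> the quotient \<open>(1 - F(y)) / y\<close> extends to a
  positive continuous function, and compactness bounds it from both sides.
\<close>

definition hyp_coeff :: "real \<Rightarrow> nat \<Rightarrow> real" where
  "hyp_coeff b n = (-1) ^ n / (fact n * pochhammer b n)"

definition hyp01 :: "real \<Rightarrow> real \<Rightarrow> real" where
  "hyp01 b y = (\<Sum>n. hyp_coeff b n * y ^ n)"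

text \<open>Explicit \<open>diffs\<close> series instead of \<open>deriv\<close>, so that the
  differential equation can be verified coefficient by coefficient.\<close>

definition hyp01' :: "real \<Rightarrow> real \<Rightarrow> real" where
  "hyp01' b y = (\<Sum>n. diffs (hyp_coeff b) n * y ^ n)"

definition hyp01'' :: "real \<Rightarrow> real \<Rightarrow> real" where
  "hyp01'' b y = (\<Sum>n. diffs (diffs (hyp_coeff b)) n * y ^ n)"

definition hyp_energy :: "real \<Rightarrow> real \<Rightarrow> real" where
  "hyp_energy b y = (hyp01 b y)\<^sup>2 + y * (hyp01' b y)\<^sup>2"

lemma hyp_coeff_0 [simp]: "hyp_coeff b 0 = 1"
  by (simp add: hyp_coeff_def)

lemma hyp_coeff_Suc:
  "hyp_coeff b (Suc n) = - hyp_coeff b n / (real (Suc n) * (b + real n))"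
  by (simp add: hyp_coeff_def pochhammer_Suc mult_ac)

lemma summable_hyp_coeff:
  assumes "b > 0"
  shows "summable (\<lambda>n. hyp_coeff b n * y ^ n)"
proof -
  obtain N0 :: nat where N0: "real N0 \<ge> 2 * \<bar>y\<bar>" using real_arch_simple by blast
  show ?thesis
  proof (rule summable_ratio_test[of "1/2" "Suc N0"])
    fix n assume n: "n \<ge> Suc N0"
    \<comment> \<open>Starting at \<open>Suc N0\<close> forces n \<ge> 1, hence b + n \<ge> 1 even
      for small b; the other factor exceeds \<open>N0\<close>.\<close>
    have "2 * \<bar>y\<bar> * 1 \<le> real (Suc n) * (b + real n)"
      using n N0 assms by (intro mult_mono) auto
    then have "\<bar>y\<bar> / (real (Suc n) * (b + real n)) \<le> 1/2"
      using assms n by (simp add: divide_simps add_pos_nonneg)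
    then have "\<bar>hyp_coeff b n * y ^ n\<bar> * (\<bar>y\<bar> / (real (Suc n) * (b + real n)))
        \<le> \<bar>hyp_coeff b n * y ^ n\<bar> * (1/2)"
      by (intro mult_left_mono) auto
    moreover have "\<bar>hyp_coeff b (Suc n) * y ^ Suc n\<bar>
        = \<bar>hyp_coeff b n * y ^ n\<bar> * (\<bar>y\<bar> / (real (Suc n) * (b + real n)))"
      using assms by (simp add: hyp_coeff_Suc abs_mult abs_divide mult_ac del: of_nat_Suc)
    ultimately show "norm (hyp_coeff b (Suc n) * y ^ Suc n) \<le> 1/2 * norm (hyp_coeff b n * y ^ n)"
      by simp
  qed simp
qed

lemma summable_diffs_hyp_coeff:
  assumes "b > 0"
  shows "summable (\<lambda>n. diffs (hyp_coeff b) n * y ^ n)"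
  using termdiff_converges_all[OF summable_hyp_coeff[OF assms]] .

lemma hyp01_deriv:
  assumes "b > 0"
  shows "(hyp01 b has_real_derivative hyp01' b y) (at y)"
  unfolding hyp01_def[abs_def] hyp01'_def
  by (rule termdiffs_strong_converges_everywhere) (rule summable_hyp_coeff[OF assms])

lemma hyp01'_deriv:
  assumes "b > 0"
  shows "(hyp01' b has_real_derivative hyp01'' b y) (at y)"
  unfolding hyp01'_def[abs_def] hyp01''_def
  by (rule termdiffs_strong_converges_everywhere) (rule summable_diffs_hyp_coeff[OF assms])

lemma hyp01_0 [simp]: "hyp01 b 0 = 1"
  by (simp add: hyp01_def)

text \<open>Comparing coefficients of y^n reduces this to the recursion (n + 1) (b + n) c(n + 1) = -
  c(n) for c = \<open>hyp_coeff b\<close>.\<close>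

lemma hyp01_ode:
  assumes "b > 0"
  shows "y * hyp01'' b y + b * hyp01' b y + hyp01 b y = 0"
proof -
  have "summable (\<lambda>n. diffs (diffs (hyp_coeff b)) n * y ^ n)"
    using termdiff_converges_all[OF summable_diffs_hyp_coeff[OF assms]] .
  then have "(\<lambda>n. real n * diffs (hyp_coeff b) n * y ^ (n - Suc 0)) sums hyp01'' b y"
    unfolding hyp01''_def by (rule diffs_equiv)
  then have "(\<lambda>n. y * (real n * diffs (hyp_coeff b) n * y ^ (n - Suc 0))) sums (y * hyp01'' b y)"
    by (rule sums_mult)
  \<comment> \<open>The truncated exponent at n = 0 is harmless, since the factor
    \<open>real n\<close> vanishes there.\<close>
  moreover have "y * (real n * diffs (hyp_coeff b) n * y ^ (n - Suc 0))
      = real n * diffs (hyp_coeff b) n * y ^ n" for n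
    by (cases n) auto
  ultimately have 1: "(\<lambda>n. real n * diffs (hyp_coeff b) n * y ^ n) sums (y * hyp01'' b y)"
    by simp
  have 2: "(\<lambda>n. b * (diffs (hyp_coeff b) n * y ^ n)) sums (b * hyp01' b y)"
    unfolding hyp01'_def
    by (intro sums_mult summable_sums summable_diffs_hyp_coeff assms)
  have 3: "(\<lambda>n. hyp_coeff b n * y ^ n) sums hyp01 b y"
    unfolding hyp01_def by (intro summable_sums summable_hyp_coeff assms)
  have "real n * diffs (hyp_coeff b) n * y ^ n + b * (diffs (hyp_coeff b) n * y ^ n)
      + hyp_coeff b n * y ^ n = 0" for n
  proof -
    have "(b + real n) * diffs (hyp_coeff b) n + hyp_coeff b n = 0"
      using assms add_pos_nonneg[of b "real n"]
      by (simp add: diffs_def hyp_coeff_Suc del: of_nat_Suc)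
    then have "((b + real n) * diffs (hyp_coeff b) n + hyp_coeff b n) * y ^ n = 0"
      by simp
    then show ?thesis by (simp add: algebra_simps)
  qed
  then show ?thesis
    using sums_add[OF sums_add[OF 1 2] 3] by (simp add: sums_unique2[OF _ sums_zero])
qed

text \<open>The equation turns 2 F' (F + y F'') into - 2 b F'^2; differentiating the weight y in the
  energy adds one F'^2.\<close>

lemma hyp_energy_deriv:
  assumes "b > 0"
  shows "(hyp_energy b has_real_derivative - (2 * b - 1) * (hyp01' b y)\<^sup>2) (at y)"
proof -
  have "(hyp_energy b has_real_derivative
      2 * hyp01 b y * hyp01' b y + ((hyp01' b y)\<^sup>2 + y * (2 * hyp01' b y * hyp01'' b y))) (at y)"
    unfolding hyp_energy_def[abs_def]
    by (rule derivative_eq_intros hyp01_deriv hyp01'_deriv assms refl | simp)+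
  moreover have "2 * hyp01 b y * hyp01' b y + ((hyp01' b y)\<^sup>2 + y * (2 * hyp01' b y * hyp01'' b y))
      = - (2 * b - 1) * (hyp01' b y)\<^sup>2"
    using hyp01_ode[OF assms, of y] by algebra
  ultimately show ?thesis by simp
qed

lemma hyp_energy_antimono:
  assumes "b > 1/2" "x \<le> y"
  shows "hyp_energy b y \<le> hyp_energy b x"
proof (rule DERIV_nonpos_imp_nonincreasing[OF assms(2)])
  fix z
  show "\<exists>d. (hyp_energy b has_real_derivative d) (at z) \<and> d \<le> 0"
    using hyp_energy_deriv[of b z] assms(1) by (intro exI[of _ "- (2 * b - 1) * (hyp01' b z)\<^sup>2"])
      (auto simp: mult_nonneg_nonneg mult_nonpos_nonneg)
qed

lemma hyp_energy_less_1:
  assumes b: "b > 1/2" and y: "y > 0"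
  shows "hyp_energy b y < 1"
proof (rule ccontr)
  assume "\<not> hyp_energy b y < 1"
  moreover have E0: "hyp_energy b 0 = 1" by (simp add: hyp_energy_def)
  \<comment> \<open>Monotonicity squeezes the energy between its values at 0 and y.\<close>
  ultimately have E: "hyp_energy b z = 1" if "z \<in> {0<..<y}" for z
    using hyp_energy_antimono[OF b, of 0 z] hyp_energy_antimono[OF b, of z y] that by auto
  have F': "hyp01' b z = 0" if z: "z \<in> {0<..<y}" for z
  proof -
    have "(hyp_energy b has_real_derivative 0) (at z)"
      by (rule has_field_derivative_transform_within_open[of "\<lambda>_. 1" _ _ "{0<..<y}"])
        (use z E in auto)
    then have "- (2 * b - 1) * (hyp01' b z)\<^sup>2 = 0"
      using DERIV_unique hyp_energy_deriv[of b z] b by fastforce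
    then show ?thesis using b by auto
  qed
  define z where "z = y / 2"
  have z: "z \<in> {0<..<y}" using y by (simp add: z_def)
  \<comment> \<open>F' vanishes on a neighbourhood of the midpoint, so F'' vanishes at it too, and
    the equation leaves F = 0.\<close>
  have "(hyp01' b has_real_derivative 0) (at z)"
    by (rule has_field_derivative_transform_within_open[of "\<lambda>_. 0" _ _ "{0<..<y}"])
      (use z F' in auto)
  then have "hyp01'' b z = 0"
    using DERIV_unique hyp01'_deriv[of b z] b by fastforce
  then have "hyp01 b z = 0"
    using hyp01_ode[of b z] F'[OF z] b by simp
  then show False
    using E[OF z] F'[OF z] by (simp add: hyp_energy_def)
qed

lemma abs_hyp01_le_sqrt_energy:
  assumes "y \<ge> 0"
  shows "\<bar>hyp01 b y\<bar> \<le> sqrt (hyp_energy b y)"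
  by (rule real_le_rsqrt) (use assms in \<open>simp add: hyp_energy_def\<close>)

lemma abs_hyp01_less_1:
  assumes "b > 1/2" "y > 0"
  shows "\<bar>hyp01 b y\<bar> < 1"
proof -
  have "sqrt (hyp_energy b y) < 1"
    using hyp_energy_less_1[OF assms] by simp
  then show ?thesis using abs_hyp01_le_sqrt_energy[of y b] assms by linarith
qed

lemma one_minus_hyp01_bounds:
  assumes b: "b > 1/2"
  obtains c1 c2 where "c1 > 0" "c2 > 0"
    "\<And>y. y > 0 \<Longrightarrow> c1 * min 1 y \<le> 1 - hyp01 b y"
    "\<And>y. y > 0 \<Longrightarrow> 1 - hyp01 b y \<le> c2 * min 1 y"
proof -
  \<comment> \<open>The quotient (1 - F(y)) / y, continued to y = 0 by its power series, with value
    1 / b there.\<close>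
  define G where "G y = - (\<Sum>n. hyp_coeff b (Suc n) * y ^ n)" for y
  have summ: "summable (\<lambda>n. hyp_coeff b (Suc n) * y ^ n)" for y
    using summable_hyp_coeff[of b y] b powser_split_head(3) by fastforce
  have G: "1 - hyp01 b y = y * G y" for y
    using powser_split_head(1)[OF summable_hyp_coeff, of b y] b
    by (simp add: hyp01_def G_def mult.commute)
  have cont: "continuous_on {0..1} G"
    unfolding G_def
    by (intro continuous_on_minus continuous_at_imp_continuous_on ballI
          DERIV_isCont[OF termdiffs_strong_converges_everywhere] summ)
  have G_pos: "G y > 0" if "y \<ge> 0" for y
  proof (cases "y = 0")
    case True
    then show ?thesis
      using b by (simp only: G_def powser_zero) (simp add: hyp_coeff_Suc)
  next
    case False
    with that have "y > 0" by simp
    then have "y * G y > 0"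
      using abs_hyp01_less_1[OF b, of y] G[of y] by linarith
    then show ?thesis using \<open>y > 0\<close> by (simp add: zero_less_mult_iff)
  qed
  obtain y1 where y1: "y1 \<in> {0..1}" "\<And>y. y \<in> {0..1} \<Longrightarrow> G y1 \<le> G y"
    using continuous_attains_inf[OF _ _ cont] by fastforce
  obtain y2 where y2: "y2 \<in> {0..1}" "\<And>y. y \<in> {0..1} \<Longrightarrow> G y \<le> G y2"
    using continuous_attains_sup[OF _ _ cont] by fastforce
  \<comment> \<open>The pointwise bound |F| < 1 gives no uniform gap on [1, \<infinity>); the
    decreasing energy does, through its value at 1.\<close>
  define s where "s = sqrt (hyp_energy b 1)"
  have s: "s < 1" using hyp_energy_less_1[OF b, of 1] by (simp add: s_def)
  have far: "\<bar>hyp01 b y\<bar> \<le> s" if "y \<ge> 1" for y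
    using abs_hyp01_le_sqrt_energy[of y b] hyp_energy_antimono[OF b that] that
    unfolding s_def by (smt (verit) real_sqrt_le_mono)
  show thesis
  proof
    \<comment> \<open>The extrema of \<open>G\<close> serve for y \<le> 1. Beyond 1, the lower
      constant is 1 - s and the upper one is 2, from |F| < 1.\<close>
    show "min (G y1) (1 - s) > 0" using G_pos y1 s by auto
    show "max (G y2) 2 > 0" by simp
    fix y :: real assume y: "y > 0"
    show "min (G y1) (1 - s) * min 1 y \<le> 1 - hyp01 b y"
    proof (cases "y \<le> 1")
      case True
      have "min (G y1) (1 - s) * y \<le> G y * y"
        using y1(2)[of y] y True by (intro mult_right_mono) auto
      then show ?thesis using True by (simp add: G mult.commute min_def)
    next
      case False
      then show ?thesis using far[of y] by auto
    qed
    show "1 - hyp01 b y \<le> max (G y2) 2 * min 1 y"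
    proof (cases "y \<le> 1")
      case True
      have "G y * y \<le> max (G y2) 2 * y"
        using y2(2)[of y] y True by (intro mult_right_mono) auto
      then show ?thesis using True by (simp add: G mult.commute min_def)
    next
      case False
      then show ?thesis using abs_hyp01_less_1[OF b y] by (simp add: min_def)
    qed
  qed
qed

text \<open>Termwise, Gamma(m + a + 1) is Gamma(a + 1) times a Pochhammer symbol, and (x/2)^(2m + a)
  splits off (x/2)^a. The factors independent of m form 1 / \<open>K\<close>, which the
  normalization of j cancels.\<close>

lemma normalized_bessel_j_eq_hyp01:
  assumes a: "a > -1" and x: "x > 0"
  shows "normalized_bessel_j a x = hyp01 (a + 1) (x\<^sup>2 / 4)"
proof -
  have Gp: "Gamma (a + 1) > 0" using a by simp
  define K where "K = Gamma (a + 1) * (2 / x) powr a"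
  have K: "K \<noteq> 0" using Gp x by (simp add: K_def)
  have "(-1) ^ m / fact m * rGamma (real m + a + 1) * (x / 2) powr (2 * real m + a)
      = inverse K * (hyp_coeff (a + 1) m * (x\<^sup>2 / 4) ^ m)" for m
  proof -
    have "pochhammer (a + 1) m = Gamma (a + 1 + real m) / Gamma (a + 1)"
      using a by (intro pochhammer_Gamma) (auto elim!: nonpos_Ints_cases)
    then have 1: "rGamma (real m + a + 1) = inverse (Gamma (a + 1)) / pochhammer (a + 1) m"
      using Gp by (simp add: rGamma_inverse_Gamma field_simps)
    have 2: "(x / 2) powr (2 * real m + a) = (x\<^sup>2 / 4) ^ m * inverse ((2 / x) powr a)"
    proof -
      have "(x / 2) powr (2 * real m + a) = (x / 2) powr real (2 * m) * (x / 2) powr a"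
        by (simp add: powr_add)
      also have "(x / 2) powr real (2 * m) = (x\<^sup>2 / 4) ^ m"
        using x by (subst powr_realpow) (auto simp: power_mult power_divide)
      also have "(x / 2) powr a = inverse ((2 / x) powr a)"
        using x by (simp add: powr_divide)
      finally show ?thesis .
    qed
    show ?thesis
      unfolding 1 2 hyp_coeff_def K_def
      by (simp only: divide_inverse inverse_mult_distrib mult_ac)
  qed
  then have "bessel_J a x = inverse K * hyp01 (a + 1) (x\<^sup>2 / 4)"
    unfolding bessel_J_def hyp01_def
    using a by (simp add: suminf_mult summable_hyp_coeff)
  moreover have "2 powr a * Gamma (a + 1) * x powr (- a) = K"
    using x by (simp add: K_def powr_divide powr_minus_divide)
  ultimately show ?thesis
    using x K by (simp add: normalized_bessel_j_def)
qed

theorem lemma3: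
  fixes \<alpha> :: real
  assumes "\<alpha> > - 1 / 2"
  shows "\<exists>c1 c2 :: real. c1 > 0 \<and> c2 > 0 \<and>
    (\<forall>l t :: real. l > 0 \<longrightarrow> t > 0 \<longrightarrow>
       c1 * min 1 ((l * t)\<^sup>2) \<le> 1 - normalized_bessel_j \<alpha> (l * t) \<and>
       1 - normalized_bessel_j \<alpha> (l * t) \<le> c2 * min 1 ((l * t)\<^sup>2))"
proof -
  have "\<alpha> + 1 > 1/2" using assms by simp
  from one_minus_hyp01_bounds[OF this] obtain c1 c2 where c: "c1 > 0" "c2 > 0"
    and lower: "\<And>y. y > 0 \<Longrightarrow> c1 * min 1 y \<le> 1 - hyp01 (\<alpha> + 1) y"
    and upper: "\<And>y. y > 0 \<Longrightarrow> 1 - hyp01 (\<alpha> + 1) y \<le> c2 * min 1 y"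
    by metis
  have "c1 / 4 * min 1 (x\<^sup>2) \<le> 1 - normalized_bessel_j \<alpha> x \<and>
      1 - normalized_bessel_j \<alpha> x \<le> c2 * min 1 (x\<^sup>2)" if x: "x > 0" for x :: real
  proof -
    have j: "normalized_bessel_j \<alpha> x = hyp01 (\<alpha> + 1) (x\<^sup>2 / 4)"
      using assms x by (intro normalized_bessel_j_eq_hyp01) auto
    have y: "x\<^sup>2 / 4 > 0" "x\<^sup>2 / 4 \<le> x\<^sup>2" using x by auto
    \<comment> \<open>The argument x^2 / 4 of F costs a factor 4 in the lower constant only; the
      upper one survives because x^2 / 4 \<le> x^2.\<close>
    have "c1 * (min 1 (x\<^sup>2) / 4) \<le> c1 * min 1 (x\<^sup>2 / 4)"
      using c by (intro mult_left_mono) auto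
    moreover have "c2 * min 1 (x\<^sup>2 / 4) \<le> c2 * min 1 (x\<^sup>2)"
      using c y by (intro mult_left_mono min.mono) auto
    ultimately show ?thesis
      using lower[OF y(1)] upper[OF y(1)] unfolding j by simp
  qed
  then show ?thesis
    using c by (intro exI[of _ "c1 / 4"] exI[of _ c2]) simp
qed

end
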